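(* Let $A\in\mathbb{R}^{d\times d}$ be invertible, $\bm{b}\in\mathbb{R}^d$, $\bm{x}^\ast=A^{-1}\bm{b}$, $\bm{x}_0\in\mathbb{R}^d$, $\Sigma_0$ symmetric positive-definite. Let $\bm{x}_m$ be the BayesCG mean, defined by the recursion: $\bm{r}_0=\bm{b}-A\bm{x}_0$, $\tilde{\bm{s}}_1=\bm{r}_0$, $\bm{s}_k=\tilde{\bm{s}}_k/\|\tilde{\bm{s}}_k\|_{A\Sigma_0A^\top}$, $\bm{x}_k=\bm{x}_0+\Sigma_0A^\top S_k\Lambda_k^{-1}S_k^\top\bm{r}_0$ with $S_k=[\bm{s}_1,\dots,\bm{s}_k]$ and $\Lambda_k=S_k^\top A\Sigma_0A^\top S_k$, $\bm{r}_k=\bm{b}-A\bm{x}_k$, $\tilde{\bm{s}}_{k+1}=\bm{r}_k-\langle\bm{s}_k,\bm{r}_k\rangle_{A\Sigma_0A^\top}\bm{s}_k$, assuming $\tilde{\bm{s}}_1,\dots,\tilde{\bm{s}}_m\ne\bm{0}$. For $n\ge0$, let $K_n(M,\bm{v})=\operatorname{span}(\bm{v},M\bm{v},\dots,M^n\bm{v})$ and $K_n^\ast=\{\bm{x}_0+\bm{v}:\bm{v}\in K_n(\Sigma_0A^\top A,\Sigma_0A^\top\bm{r}_0)\}$. Then \[\bm{x}_m=\operatorname*{arg\,min}_{\bm{x}\in K_{m-1}^\ast}\|\bm{x}-\bm{x}^\ast\|_{\Sigma_0^{-1}}.\]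
   Context: $\langle\bm{u},\bm{v}\rangle_{B}=\bm{u}^\top B\bm{v}$ and $\|\bm{v}\|_B=\sqrt{\bm{v}^\top B\bm{v}}$ for symmetric positive-definite $B$. *)

theory Defs
  imports "HOL-Analysis.Analysis"
begin

section \<open>Weighted inner product and norm\<close>

definition winner :: "real^'d^'d \<Rightarrow> real^'d \<Rightarrow> real^'d \<Rightarrow> real" where
  "winner B u v = u \<bullet> (B *v v)"

definition wnorm :: "real^'d^'d \<Rightarrow> real^'d \<Rightarrow> real" where
  "wnorm B v = sqrt (v \<bullet> (B *v v))"

definition sym_pos_def :: "real^'d^'d \<Rightarrow> bool" where
  "sym_pos_def S \<longleftrightarrow> transpose S = S \<and> (\<forall>v. v \<noteq> 0 \<longrightarrow> v \<bullet> (S *v v) > 0)"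

section \<open>Inverse of a k x k matrix given by its entries (indices 0..k-1)\<close>

definition sq_inv :: "nat \<Rightarrow> (nat \<Rightarrow> nat \<Rightarrow> real) \<Rightarrow> (nat \<Rightarrow> nat \<Rightarrow> real)" where
  "sq_inv k L = (THE Li.
      (\<forall>i<k. \<forall>j<k. (\<Sum>l<k. L i l * Li l j) = (if i = j then 1 else 0)) \<and>
      (\<forall>i<k. \<forall>j<k. (\<Sum>l<k. Li i l * L l j) = (if i = j then 1 else 0)) \<and>
      (\<forall>i j. k \<le> i \<or> k \<le> j \<longrightarrow> Li i j = 0))"

section \<open>BayesCG recursion\<close>

text \<open>S is the list [s_1, ..., s_k] (so S ! i = s_(i+1)).
  bcg_x gives x_k = x_0 + Sigma A^T S_k Lambda_k^{-1} S_k^T r_0 with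
  Lambda_k = S_k^T (A Sigma A^T) S_k, written out entrywise.\<close>

definition bcg_x :: "real^'d^'d \<Rightarrow> real^'d^'d \<Rightarrow> real^'d \<Rightarrow> real^'d \<Rightarrow> (real^'d) list \<Rightarrow> real^'d" where
  "bcg_x A Sig b x0 S =
     (let B = A ** Sig ** transpose A; r0 = b - A *v x0; k = length S;
          Lam = (\<lambda>i j. (S ! i) \<bullet> (B *v (S ! j)));
          Li = sq_inv k Lam
      in x0 + (Sig ** transpose A) *v
              (\<Sum>i<k. (\<Sum>j<k. Li i j * ((S ! j) \<bullet> r0)) *\<^sub>R (S ! i)))"

text \<open>Unnormalised next direction: s~_1 = r_0 if S = [], otherwise
  s~_(k+1) = r_k - <s_k, r_k>_B s_k with r_k = b - A x_k.\<close>

definition bcg_st :: "real^'d^'d \<Rightarrow> real^'d^'d \<Rightarrow> real^'d \<Rightarrow> real^'d \<Rightarrow> (real^'d) list \<Rightarrow> real^'d" where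
  "bcg_st A Sig b x0 S =
     (let B = A ** Sig ** transpose A in
      if S = [] then b - A *v x0
      else (let r = b - A *v bcg_x A Sig b x0 S
            in r - winner B (last S) r *\<^sub>R last S))"

fun bcg_dirs :: "real^'d^'d \<Rightarrow> real^'d^'d \<Rightarrow> real^'d \<Rightarrow> real^'d \<Rightarrow> nat \<Rightarrow> (real^'d) list" where
  "bcg_dirs A Sig b x0 0 = []"
| "bcg_dirs A Sig b x0 (Suc k) =
     (let S = bcg_dirs A Sig b x0 k; t = bcg_st A Sig b x0 S
      in S @ [(1 / wnorm (A ** Sig ** transpose A) t) *\<^sub>R t])"

text \<open>s~_k for k >= 1 and the BayesCG mean x_k.\<close>

definition bcg_stilde :: "real^'d^'d \<Rightarrow> real^'d^'d \<Rightarrow> real^'d \<Rightarrow> real^'d \<Rightarrow> nat \<Rightarrow> real^'d" where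
  "bcg_stilde A Sig b x0 k = bcg_st A Sig b x0 (bcg_dirs A Sig b x0 (k - 1))"

definition bcg_mean :: "real^'d^'d \<Rightarrow> real^'d^'d \<Rightarrow> real^'d \<Rightarrow> real^'d \<Rightarrow> nat \<Rightarrow> real^'d" where
  "bcg_mean A Sig b x0 k = bcg_x A Sig b x0 (bcg_dirs A Sig b x0 k)"

section \<open>Krylov spaces\<close>

definition krylov :: "nat \<Rightarrow> real^'d^'d \<Rightarrow> real^'d \<Rightarrow> (real^'d) set" where
  "krylov n M v = span {(((*v) M) ^^ i) v | i. i \<le> n}"

end

theory Submission
  imports Defs "Jordan_Normal_Form.Determinant"
begin

(* With B = A Sigma A^T and r_0 = b - A x_0, the BayesCG mean is x_k = x_0 + Sigma A^T w_k, where
   w_k in span S_k solves the Galerkin equations S_k^T (r_0 - B w_k) = 0; so the residual r_k is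
   orthogonal to span S_k.  By induction the directions are linearly independent and lie in
   K_{k-1}(B, r_0): the new direction is built from r_0, B w_k and s_k, and it cannot lie in
   span S_k, for then r_k would lie there as well and hence vanish.  Counting dimensions,
   span S_m = K_{m-1}(B, r_0), which Sigma A^T maps onto K_{m-1}(Sigma A^T A, Sigma A^T r_0).
   Finally, for x = x_0 + Sigma A^T u with u in span S_m, the Sigma^{-1}-inner product of
   e = x_m - x* with x - x_m = Sigma A^T (u - w_m) equals (A e)^T (u - w_m) = -r_m^T (u - w_m) = 0,
   and Pythagoras gives strict minimality. *)

lemma nonsingular_two_sided_inverse:
  fixes L :: "nat \<Rightarrow> nat \<Rightarrow> real"
  assumes ker: "\<And>c. \<forall>i<k. (\<Sum>j<k. L i j * c j) = 0 \<Longrightarrow> \<forall>j<k. c j = 0"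
  shows "\<exists>Li. (\<forall>i<k. \<forall>j<k. (\<Sum>l<k. L i l * Li l j) = (if i = j then 1 else 0)) \<and>
      (\<forall>i<k. \<forall>j<k. (\<Sum>l<k. Li i l * L l j) = (if i = j then 1 else 0)) \<and>
      (\<forall>i j. k \<le> i \<or> k \<le> j \<longrightarrow> Li i j = 0)"
proof -
  define M :: "real mat" where "M = mat k k (\<lambda>(i, j). L i j)"
  have M: "M \<in> carrier_mat k k" unfolding M_def by simp
  have "Determinant.det M \<noteq> 0"
  proof
    assume "Determinant.det M = 0"
    then obtain v where v: "v \<in> carrier_vec k" "v \<noteq> 0\<^sub>v k" "M *\<^sub>v v = 0\<^sub>v k"
      using det_0_iff_vec_prod_zero[OF M] by blast
    have "\<forall>i<k. (\<Sum>j<k. L i j * v $ j) = 0"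
    proof (intro allI impI)
      fix i assume i: "i < k"
      have "(M *\<^sub>v v) $ i = 0" using v(3) i by simp
      then show "(\<Sum>j<k. L i j * v $ j) = 0"
        using i v(1) by (simp add: M_def scalar_prod_def lessThan_atLeast0)
    qed
    then have "v = 0\<^sub>v k" using ker v(1) by (intro eq_vecI) auto
    with v(2) show False by simp
  qed
  then have "M \<in> Units (ring_mat TYPE(real) k ())" by (rule det_non_zero_imp_unit[OF M])
  then obtain N where N: "N \<in> carrier_mat k k" "N * M = 1\<^sub>m k" "M * N = 1\<^sub>m k"
    unfolding Units_def ring_mat_def by auto
  define Li where "Li = (\<lambda>i j. if i < k \<and> j < k then N $$ (i, j) else 0)"
  have right: "(\<Sum>l<k. L i l * Li l j) = (if i = j then 1 else 0)" if "i < k" "j < k" for i j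
  proof -
    have "(M * N) $$ (i, j) = (if i = j then 1 else 0)" using N(3) that by simp
    then show ?thesis using that N(1)
      by (simp add: M_def Li_def scalar_prod_def lessThan_atLeast0 row_def col_def)
  qed
  have left: "(\<Sum>l<k. Li i l * L l j) = (if i = j then 1 else 0)" if "i < k" "j < k" for i j
  proof -
    have "(N * M) $$ (i, j) = (if i = j then 1 else 0)" using N(2) that by simp
    then show ?thesis using that N(1)
      by (simp add: M_def Li_def scalar_prod_def lessThan_atLeast0 row_def col_def)
  qed
  show ?thesis
    by (rule exI[of _ Li]) (use left right in \<open>auto simp: Li_def\<close>)
qed

lemma sq_inv_right_inverse:
  fixes L :: "nat \<Rightarrow> nat \<Rightarrow> real"
  assumes ker: "\<And>c. \<forall>i<k. (\<Sum>j<k. L i j * c j) = 0 \<Longrightarrow> \<forall>j<k. c j = 0"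
    and "i < k" "j < k"
  shows "(\<Sum>l<k. L i l * sq_inv k L l j) = (if i = j then 1 else 0)"
proof -
  define P where "P = (\<lambda>Li. (\<forall>i<k. \<forall>j<k. (\<Sum>l<k. L i l * Li l j) = (if i = j then 1 else 0)) \<and>
      (\<forall>i<k. \<forall>j<k. (\<Sum>l<k. Li i l * L l j) = (if i = j then 1 else 0)) \<and>
      (\<forall>i j. k \<le> i \<or> k \<le> j \<longrightarrow> (Li i j :: real) = 0))"
  have unique: "X = Y" if X: "P X" and Y: "P Y" for X Y
  proof (intro ext)
    fix i j
    show "X i j = Y i j"
    proof (cases "i < k \<and> j < k")
      case True
      have "Y i j = (\<Sum>l<k. (if i = l then 1 else 0) * Y l j)"
        using True by (simp add: mult_delta_left)
      also have "\<dots> = (\<Sum>l<k. (\<Sum>n<k. X i n * L n l) * Y l j)"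
        using X True unfolding P_def by (intro sum.cong) auto
      also have "\<dots> = (\<Sum>n<k. X i n * (\<Sum>l<k. L n l * Y l j))"
        unfolding sum_distrib_right sum_distrib_left mult.assoc by (rule sum.swap)
      also have "\<dots> = (\<Sum>n<k. X i n * (if n = j then 1 else 0))"
        using Y True unfolding P_def by (intro sum.cong) auto
      also have "\<dots> = X i j" using True by (simp add: mult_delta_right)
      finally show ?thesis by simp
    next
      case False
      then show ?thesis using X Y unfolding P_def by auto
    qed
  qed
  have "\<exists>Li. P Li" unfolding P_def by (rule nonsingular_two_sided_inverse[OF ker])
  then have "\<exists>!Li. P Li" using unique by blast
  then have "P (THE Li. P Li)" by (rule theI')
  moreover have "sq_inv k L = (THE Li. P Li)" unfolding sq_inv_def P_def by simp
  ultimately have "P (sq_inv k L)" by simp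
  then show ?thesis using assms(2,3) unfolding P_def by blast
qed

lemma independent_list_coeffs_zero:
  fixes S :: "'a::real_vector list"
  assumes "distinct S" "independent (set S)" "(\<Sum>i<length S. c i *\<^sub>R S ! i) = 0" "i < length S"
  shows "c i = 0"
proof -
  have inj: "inj_on ((!) S) {..<length S}" using assms(1) by (simp add: inj_on_nth)
  have img: "(!) S ` {..<length S} = set S" by (auto simp: in_set_conv_nth)
  define u where "u = (\<lambda>v. c (the_inv_into {..<length S} ((!) S) v))"
  have u: "u (S ! j) = c j" if "j < length S" for j
    using the_inv_into_f_f[OF inj] that by (simp add: u_def)
  have "(\<Sum>v\<in>set S. u v *\<^sub>R v) = (\<Sum>j<length S. u (S ! j) *\<^sub>R S ! j)"
    unfolding img[symmetric] by (rule sum.reindex[OF inj, unfolded comp_def])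
  also have "\<dots> = 0" using assms(3) u by simp
  finally have "\<forall>v\<in>set S. u v = 0"
    using assms(2) real_vector.dependent_finite[of "set S"] by auto
  then show ?thesis using assms(4) u by force
qed

lemma matrix_vector_mult_sum: "(M::'a::comm_ring_1^'n^'m) *v (\<Sum>i\<in>I. f i) = (\<Sum>i\<in>I. M *v f i)"
  by (induction I rule: infinite_finite_induct) (auto simp: matrix_vector_right_distrib)

definition posdef :: "real^'d^'d \<Rightarrow> bool" where
  "posdef B \<longleftrightarrow> (\<forall>v. v \<noteq> 0 \<longrightarrow> v \<bullet> (B *v v) > 0)"

lemma gram_kernel_trivial:
  fixes S :: "(real^'d) list"
  assumes "posdef B" "distinct S" "independent (set S)"
    and "\<forall>i<length S. (\<Sum>j<length S. (S ! i \<bullet> (B *v S ! j)) * c j) = 0"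
  shows "\<forall>j<length S. c j = 0"
proof -
  define w where "w = (\<Sum>j<length S. c j *\<^sub>R S ! j)"
  have "B *v w = (\<Sum>j<length S. c j *\<^sub>R (B *v S ! j))"
    unfolding w_def by (simp add: matrix_vector_mult_sum matrix_vector_mult_scaleR)
  then have "S ! i \<bullet> (B *v w) = 0" if "i < length S" for i
    using assms(4) that by (simp add: inner_sum_right mult.commute)
  then have "w \<bullet> (B *v w) = 0" unfolding w_def by (simp add: inner_sum_left)
  then have "w = 0" using assms(1) unfolding posdef_def by force
  then show ?thesis using independent_list_coeffs_zero[OF assms(2,3)] unfolding w_def by blast
qed

definition galerkin :: "real^'d^'d \<Rightarrow> real^'d \<Rightarrow> (real^'d) list \<Rightarrow> real^'d" where
  "galerkin B r S =
     (let k = length S; Li = sq_inv k (\<lambda>i j. S ! i \<bullet> (B *v S ! j))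
      in \<Sum>i<k. (\<Sum>j<k. Li i j * (S ! j \<bullet> r)) *\<^sub>R S ! i)"

lemma galerkin_in_span: "galerkin B r S \<in> span (set S)"
  unfolding galerkin_def Let_def by (intro span_sum span_scale span_base) auto

lemma galerkin_orthogonal:
  fixes S :: "(real^'d) list"
  assumes "posdef B" "distinct S" "independent (set S)" "u \<in> span (set S)"
  shows "u \<bullet> (r - B *v galerkin B r S) = 0"
proof -
  let ?k = "length S"
  let ?L = "\<lambda>i j. S ! i \<bullet> (B *v S ! j)"
  define c where "c = (\<lambda>i. \<Sum>l<?k. sq_inv ?k ?L i l * (S ! l \<bullet> r))"
  have inv: "(\<Sum>i<?k. ?L j i * sq_inv ?k ?L i l) = (if j = l then 1 else 0)"
    if "j < ?k" "l < ?k" for j l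
    by (rule sq_inv_right_inverse[OF _ that]) (use gram_kernel_trivial[OF assms(1-3)] in blast)
  have Bw: "B *v galerkin B r S = (\<Sum>i<?k. c i *\<^sub>R (B *v S ! i))"
    unfolding galerkin_def Let_def c_def
    by (simp add: matrix_vector_mult_sum matrix_vector_mult_scaleR)
  have "S ! j \<bullet> (r - B *v galerkin B r S) = 0" if j: "j < ?k" for j
  proof -
    have "S ! j \<bullet> (B *v galerkin B r S) = (\<Sum>i<?k. ?L j i * c i)"
      unfolding Bw by (simp add: inner_sum_right mult.commute)
    also have "\<dots> = (\<Sum>i<?k. \<Sum>l<?k. ?L j i * sq_inv ?k ?L i l * (S ! l \<bullet> r))"
      unfolding c_def by (simp add: sum_distrib_left mult.assoc)
    also have "\<dots> = (\<Sum>l<?k. (\<Sum>i<?k. ?L j i * sq_inv ?k ?L i l) * (S ! l \<bullet> r))"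
      unfolding sum_distrib_right by (rule sum.swap)
    also have "\<dots> = S ! j \<bullet> r"
      using inv j by (simp add: mult_delta_left)
    finally show ?thesis by (simp add: inner_diff_right)
  qed
  then have "set S \<subseteq> {u. u \<bullet> (r - B *v galerkin B r S) = 0}"
    by (auto simp: in_set_conv_nth)
  moreover have "subspace {u. u \<bullet> (r - B *v galerkin B r S) = 0}"
    by (auto simp: subspace_def inner_add_left)
  ultimately show ?thesis using assms(4) span_minimal by blast
qed

lemma krylov_start: "v \<in> krylov n M v"
  unfolding krylov_def by (rule span_base) force

lemma krylov_mono: "n \<le> n' \<Longrightarrow> krylov n M v \<subseteq> krylov n' M v"
  unfolding krylov_def by (intro span_mono) auto

lemma krylov_mult:
  assumes "x \<in> krylov n M v"
  shows "M *v x \<in> krylov (Suc n) M v"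
proof -
  have "(*v) M ` krylov n M v = span ((*v) M ` {((*v) M ^^ i) v | i. i \<le> n})"
    unfolding krylov_def by (rule span_linear_image[symmetric]) simp
  also have "\<dots> \<subseteq> krylov (Suc n) M v"
    unfolding krylov_def by (intro span_mono) (clarsimp, metis Suc_le_mono comp_apply funpow.simps(2))
  finally show ?thesis using assms by blast
qed

lemma dim_krylov_le: "dim (krylov n M v) \<le> Suc n"
proof -
  have gens: "{((*v) M ^^ i) v | i. i \<le> n} = (\<lambda>i. ((*v) M ^^ i) v) ` {..n}" by auto
  have "dim (krylov n M v) \<le> card {((*v) M ^^ i) v | i. i \<le> n}"
    unfolding krylov_def dim_span gens by (rule dim_le_card') simp
  also have "\<dots> \<le> Suc n" unfolding gens using card_image_le[of "{..n}"] by simp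
  finally show ?thesis .
qed

lemma krylov_product: "krylov n (P ** Q) (P *v v) = (*v) P ` krylov n (Q ** P) v"
proof -
  have "((*v) (P ** Q) ^^ i) (P *v v) = P *v ((*v) (Q ** P) ^^ i) v" for i
    by (induction i) (simp_all add: matrix_vector_mul_assoc matrix_mul_assoc)
  then have "{((*v) (P ** Q) ^^ i) (P *v v) | i. i \<le> n} = (*v) P ` {((*v) (Q ** P) ^^ i) v | i. i \<le> n}"
    by auto
  then show ?thesis unfolding krylov_def by (simp add: span_linear_image)
qed

lemma length_bcg_dirs: "length (bcg_dirs A Sig b x0 k) = k"
  by (induction k) (simp_all add: Let_def)

lemma posdef_congruence:
  fixes A Sig :: "real^'d^'d"
  assumes "invertible A" "sym_pos_def Sig"
  shows "posdef (A ** Sig ** transpose A)"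
  unfolding posdef_def
proof (intro allI impI)
  fix v :: "real^'d" assume "v \<noteq> 0"
  then have y: "transpose A *v v \<noteq> 0"
    using inj_matrix_vector_mult[OF transpose_invertible[OF assms(1)]]
    by (metis injD matrix_vector_mult_0_right)
  have "v \<bullet> ((A ** Sig ** transpose A) *v v) = v \<bullet> (A *v (Sig *v (transpose A *v v)))"
    by (simp del: transpose_matrix_vector add: matrix_vector_mul_assoc matrix_mul_assoc)
  also have "\<dots> = (transpose A *v v) \<bullet> (Sig *v (transpose A *v v))"
    by (simp add: dot_lmul_matrix[symmetric])
  finally have "v \<bullet> ((A ** Sig ** transpose A) *v v) = (transpose A *v v) \<bullet> (Sig *v (transpose A *v v))" .
  then show "v \<bullet> ((A ** Sig ** transpose A) *v v) > 0"
    using assms(2) y unfolding sym_pos_def_def by simp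
qed

lemma bcg_x_galerkin:
  "bcg_x A Sig b x0 S = x0 + (Sig ** transpose A) *v galerkin (A ** Sig ** transpose A) (b - A *v x0) S"
  unfolding bcg_x_def galerkin_def Let_def by simp

lemma bcg_residual:
  "b - A *v bcg_x A Sig b x0 S =
   (b - A *v x0) - (A ** Sig ** transpose A) *v galerkin (A ** Sig ** transpose A) (b - A *v x0) S"
  unfolding bcg_x_galerkin
  by (simp add: matrix_vector_right_distrib matrix_vector_mul_assoc matrix_mul_assoc)

lemma bcg_st_in_krylov:
  assumes "set S \<subseteq> krylov (length S - 1) (A ** Sig ** transpose A) (b - A *v x0)"
  shows "bcg_st A Sig b x0 S \<in> krylov (length S) (A ** Sig ** transpose A) (b - A *v x0)"
proof (cases "S = []")
  case True
  then show ?thesis by (simp add: bcg_st_def krylov_start)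
next
  case False
  define B where "B = A ** Sig ** transpose A"
  define r0 where "r0 = b - A *v x0"
  define w where "w = galerkin B r0 S"
  obtain n where n: "length S = Suc n" using False by (cases S) auto
  have span_S: "span (set S) \<subseteq> krylov n B r0"
    using assms unfolding B_def r0_def krylov_def n by (simp add: span_minimal)
  then have "w \<in> krylov n B r0" using galerkin_in_span unfolding w_def by blast
  then have Bw: "B *v w \<in> krylov (Suc n) B r0" by (rule krylov_mult)
  have last: "last S \<in> krylov (Suc n) B r0"
    using span_S False krylov_mono[of n "Suc n" B r0] span_base[of "last S" "set S"] by auto
  have r0: "r0 \<in> krylov (Suc n) B r0" by (rule krylov_start)
  have "bcg_st A Sig b x0 S = (r0 - B *v w) - winner B (last S) (r0 - B *v w) *\<^sub>R last S"
    using False by (simp add: bcg_st_def bcg_residual Let_def B_def r0_def w_def)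
  also have "\<dots> \<in> krylov (Suc n) B r0"
    using Bw last r0 unfolding krylov_def by (intro span_diff span_scale)
  finally show ?thesis unfolding n B_def r0_def .
qed

lemma bcg_st_in_span_imp_zero:
  assumes "posdef (A ** Sig ** transpose A)" "distinct S" "independent (set S)"
    and "bcg_st A Sig b x0 S \<in> span (set S)"
  shows "bcg_st A Sig b x0 S = 0"
proof (cases "S = []")
  case True
  then show ?thesis using assms(4) by simp
next
  case False
  define r where "r = b - A *v bcg_x A Sig b x0 S"
  define c where "c = winner (A ** Sig ** transpose A) (last S) r"
  have st: "bcg_st A Sig b x0 S = r - c *\<^sub>R last S"
    using False by (simp add: bcg_st_def Let_def r_def c_def)
  have "last S \<in> span (set S)" using False by (simp add: span_base)
  then have "bcg_st A Sig b x0 S + c *\<^sub>R last S \<in> span (set S)"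
    using assms(4) by (intro span_add span_scale)
  then have "r \<in> span (set S)" unfolding st by simp
  moreover have "u \<bullet> r = 0" if "u \<in> span (set S)" for u
    using galerkin_orthogonal[OF assms(1-3) that] unfolding r_def bcg_residual by simp
  ultimately have "r = 0" by (metis inner_eq_zero_iff)
  then show ?thesis unfolding st c_def winner_def by simp
qed

lemma bcg_dirs_independent:
  assumes "invertible A" "sym_pos_def Sig"
    and nonzero: "\<forall>k\<in>{1..m}. bcg_stilde A Sig b x0 k \<noteq> 0"
    and "k \<le> m"
  shows "distinct (bcg_dirs A Sig b x0 k) \<and> independent (set (bcg_dirs A Sig b x0 k)) \<and>
    set (bcg_dirs A Sig b x0 k) \<subseteq> krylov (k - 1) (A ** Sig ** transpose A) (b - A *v x0)"
  using assms(4)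
proof (induction k)
  case 0
  then show ?case by (simp add: independent_empty)
next
  case (Suc k)
  define S where "S = bcg_dirs A Sig b x0 k"
  define t where "t = bcg_st A Sig b x0 S"
  have pd: "posdef (A ** Sig ** transpose A)" by (rule posdef_congruence[OF assms(1,2)])
  have IH: "distinct S" "independent (set S)"
      "set S \<subseteq> krylov (length S - 1) (A ** Sig ** transpose A) (b - A *v x0)"
    using Suc by (auto simp: S_def length_bcg_dirs)
  have "bcg_stilde A Sig b x0 (Suc k) \<noteq> 0" using nonzero Suc.prems by simp
  then have "t \<noteq> 0" by (simp add: t_def S_def bcg_stilde_def)
  then have t_new: "t \<notin> span (set S)"
    using bcg_st_in_span_imp_zero[OF pd IH(1,2)] unfolding t_def by blast
  define c where "c = 1 / wnorm (A ** Sig ** transpose A) t"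
  have "t \<bullet> ((A ** Sig ** transpose A) *v t) > 0" using pd \<open>t \<noteq> 0\<close> by (simp add: posdef_def)
  then have "c \<noteq> 0" by (simp add: c_def wnorm_def)
  then have ct_new: "c *\<^sub>R t \<notin> span (set S)"
    using t_new span_scale[of "c *\<^sub>R t" _ "1 / c"] by auto
  have "c *\<^sub>R t \<in> krylov k (A ** Sig ** transpose A) (b - A *v x0)"
    using bcg_st_in_krylov[OF IH(3)] unfolding t_def krylov_def S_def length_bcg_dirs
    by (intro span_scale) simp
  moreover have "set S \<subseteq> krylov k (A ** Sig ** transpose A) (b - A *v x0)"
    using IH(3) krylov_mono[of "k - 1" k] by (auto simp: S_def length_bcg_dirs)
  moreover have "bcg_dirs A Sig b x0 (Suc k) = S @ [c *\<^sub>R t]"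
    by (simp add: S_def t_def c_def Let_def)
  ultimately show ?case
    using IH ct_new span_base[of "c *\<^sub>R t" "set S"] by (auto simp: independent_insert)
qed

lemma span_bcg_dirs:
  assumes "invertible A" "sym_pos_def Sig" "m \<ge> 1"
    and "\<forall>k\<in>{1..m}. bcg_stilde A Sig b x0 k \<noteq> 0"
  shows "span (set (bcg_dirs A Sig b x0 m)) = krylov (m - 1) (A ** Sig ** transpose A) (b - A *v x0)"
proof -
  let ?S = "bcg_dirs A Sig b x0 m" and ?K = "krylov (m - 1) (A ** Sig ** transpose A) (b - A *v x0)"
  have S: "distinct ?S" "independent (set ?S)" "set ?S \<subseteq> ?K"
    using bcg_dirs_independent[OF assms(1,2,4) order.refl] by auto
  show ?thesis
  proof (rule subspace_dim_equal)
    show "span (set ?S) \<subseteq> ?K" using S(3) unfolding krylov_def by (simp add: span_minimal)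
    have "dim ?K \<le> m" using dim_krylov_le[of "m - 1"] assms(3) by simp
    also have "m = dim (span (set ?S))"
      using S(1,2) by (simp add: dim_span dim_eq_card_independent distinct_card length_bcg_dirs)
    finally show "dim ?K \<le> dim (span (set ?S))" .
  qed (simp_all add: krylov_def)
qed

lemma matrix_inv_inverse:
  fixes X :: "real^'d^'d"
  assumes "invertible X"
  shows "X ** matrix_inv X = Finite_Cartesian_Product.mat 1" "matrix_inv X ** X = Finite_Cartesian_Product.mat 1"
  using someI_ex[OF assms[unfolded invertible_def]] unfolding matrix_inv_def by auto

lemma wnorm_inv_add_orthogonal:
  fixes Sig :: "real^'d^'d" and e y :: "real^'d"
  assumes spd: "sym_pos_def Sig" and "e \<bullet> y = 0" "y \<noteq> 0"
  shows "wnorm (matrix_inv Sig) e < wnorm (matrix_inv Sig) (e + Sig *v y)"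
proof -
  let ?Q = "matrix_inv Sig"
  have "Sig *v x = 0 \<Longrightarrow> x = 0" for x
    using spd unfolding sym_pos_def_def by (metis inner_zero_right less_irrefl)
  then have "invertible Sig"
    using matrix_left_invertible_ker invertible_left_inverse by blast
  note inverse = matrix_inv_inverse[OF this]
  have Q_Sig: "?Q *v (Sig *v y) = y"
    by (simp add: matrix_vector_mul_assoc inverse)
  have "(Sig *v y) \<bullet> (?Q *v e) = (y v* Sig) \<bullet> (?Q *v e)"
    using spd unfolding sym_pos_def_def by (metis transpose_matrix_vector)
  also have "\<dots> = y \<bullet> e"
    by (simp add: dot_lmul_matrix matrix_vector_mul_assoc inverse)
  finally have cross: "(Sig *v y) \<bullet> (?Q *v e) = 0" using assms(2) by (simp add: inner_commute)
  have "y \<bullet> (Sig *v y) > 0" using spd assms(3) unfolding sym_pos_def_def by simp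
  then have "e \<bullet> (?Q *v e) < (e + Sig *v y) \<bullet> (?Q *v (e + Sig *v y))"
    using assms(2) cross Q_Sig
    by (simp add: matrix_vector_right_distrib inner_add_left inner_add_right inner_commute)
  then show ?thesis unfolding wnorm_def by simp
qed

lemma bcg_x_minimizes:
  fixes A Sig :: "real^'d^'d"
  assumes "invertible A" "sym_pos_def Sig" "distinct S" "independent (set S)"
    and "u \<in> span (set S)" and ne: "x0 + (Sig ** transpose A) *v u \<noteq> bcg_x A Sig b x0 S"
  shows "wnorm (matrix_inv Sig) (bcg_x A Sig b x0 S - matrix_inv A *v b)
       < wnorm (matrix_inv Sig) (x0 + (Sig ** transpose A) *v u - matrix_inv A *v b)"
proof -
  define w where "w = galerkin (A ** Sig ** transpose A) (b - A *v x0) S"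
  define e where "e = bcg_x A Sig b x0 S - matrix_inv A *v b"
  define y where "y = transpose A *v (u - w)"
  have "A *v (matrix_inv A *v b) = b"
    by (simp add: matrix_vector_mul_assoc matrix_inv_inverse[OF assms(1)])
  then have Ae: "A *v e = - (b - A *v bcg_x A Sig b x0 S)"
    unfolding e_def by (simp add: matrix_vector_mult_diff_distrib)
  have "u - w \<in> span (set S)"
    using assms(5) galerkin_in_span unfolding w_def by (rule span_diff)
  then have "(u - w) \<bullet> (b - A *v bcg_x A Sig b x0 S) = 0"
    using galerkin_orthogonal[OF posdef_congruence[OF assms(1,2)] assms(3,4)]
    unfolding bcg_residual w_def by blast
  then have "(u - w) \<bullet> (A *v e) = 0" unfolding Ae inner_minus_right by simp
  then have "e \<bullet> y = 0"
    unfolding y_def transpose_matrix_vector by (metis dot_lmul_matrix inner_commute)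
  moreover have "x0 + (Sig ** transpose A) *v u - matrix_inv A *v b = e + Sig *v y"
    unfolding e_def y_def bcg_x_galerkin w_def
    by (simp del: transpose_matrix_vector
        add: matrix_vector_mul_assoc matrix_vector_mult_diff_distrib algebra_simps)
  moreover have "y \<noteq> 0"
    using ne unfolding bcg_x_galerkin y_def w_def
    by (auto simp del: transpose_matrix_vector
        simp add: matrix_vector_mul_assoc[symmetric] matrix_vector_mult_diff_distrib)
  ultimately show ?thesis
    using wnorm_inv_add_orthogonal[OF assms(2)] unfolding e_def by metis
qed

theorem proposition8:
  fixes A Sig :: "real^'d^'d" and b x0 :: "real^'d" and m :: nat
  assumes "invertible A"
    and "sym_pos_def Sig"
    and "m \<ge> 1"
    and "\<forall>k\<in>{1..m}. bcg_stilde A Sig b x0 k \<noteq> 0"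
  shows "let xstar = matrix_inv A *v b;
             K = {x0 + v | v. v \<in> krylov (m - 1) (Sig ** transpose A ** A) (Sig *v (transpose A *v (b - A *v x0)))};
             xm = bcg_mean A Sig b x0 m
         in xm \<in> K \<and>
            (\<forall>x\<in>K. x \<noteq> xm \<longrightarrow> wnorm (matrix_inv Sig) (xm - xstar) < wnorm (matrix_inv Sig) (x - xstar))"
proof -
  define S where "S = bcg_dirs A Sig b x0 m"
  have "krylov (m - 1) (Sig ** transpose A ** A) (Sig *v (transpose A *v (b - A *v x0)))
      = (*v) (Sig ** transpose A) ` krylov (m - 1) (A ** Sig ** transpose A) (b - A *v x0)"
    using krylov_product[of "m - 1" "Sig ** transpose A" A]
    by (simp del: transpose_matrix_vector add: matrix_vector_mul_assoc matrix_mul_assoc)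
  also have "\<dots> = (*v) (Sig ** transpose A) ` span (set S)"
    unfolding S_def span_bcg_dirs[OF assms] ..
  finally have K: "{x0 + v | v. v \<in> krylov (m - 1) (Sig ** transpose A ** A) (Sig *v (transpose A *v (b - A *v x0)))}
      = {x0 + (Sig ** transpose A) *v u | u. u \<in> span (set S)}"
    by auto
  have "distinct S" "independent (set S)"
    using bcg_dirs_independent[OF assms(1,2,4) order.refl] unfolding S_def by auto
  moreover have "bcg_mean A Sig b x0 m \<in> {x0 + (Sig ** transpose A) *v u | u. u \<in> span (set S)}"
    unfolding bcg_mean_def bcg_x_galerkin S_def using galerkin_in_span by blast
  ultimately show ?thesis
    unfolding Let_def K using bcg_x_minimizes[OF assms(1,2)] unfolding bcg_mean_def S_def by blast
qed

end
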